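(* Let $q=4$ and $n=1+3q^a+q^e+2q^{e+a}$, where $e$ and $a$ are positive integers. Then $$g_{n,q}\equiv X^{q^a}+S_e+S_a^2S_e^2+S_aS_e^3\pmod{X^{q^e}-X}.$$ If $2\mid e$ and $\gcd(e,2a+1)=1$, then $g_{n,q}$ is a permutation polynomial of $\mathbb F_{q^e}$.
   Context: For a prime power $q$ with $p=\operatorname{char}\mathbb F_q$ and an integer $n\ge 0$, $g_{n,q}\in\mathbb F_p[X]$ is the polynomial defined by the functional equation $\sum_{c\in\mathbb F_q}(X+c)^n=g_{n,q}(X^q-X)$. For each integer $a\ge 0$, $S_a=X+X^q+\cdots+X^{q^{a-1}}$ (with $S_0=0$). Products and powers of the $S_a$ are ordinary products and powers of polynomials. A polynomial over a finite field $F$ is a permutation polynomial of $F$ if it induces a bijection $F\to F$. *)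

theory Defs
  imports
    "Berlekamp_Zassenhaus.Finite_Field"
    "HOL-Computational_Algebra.Polynomial"
begin

text \<open>
  The prime field \<open>F\<^sub>p\<close> is the type \<open>'p mod_ring\<close> with \<open>'p :: prime_card\<close>, \<open>CARD('p) = p\<close>.
  Finite fields \<open>F\<^sub>Q\<close> are arbitrary types of sort \<open>{finite, field}\<close> with \<open>Q\<close> elements.
\<close>

text \<open>
  The inclusion of the prime field into a field \<open>'k\<close>, via representatives in \<open>{0..<p}\<close>. It is a
  ring homomorphism only if \<open>'k\<close> has characteristic \<open>CARD('p)\<close>.
\<close>

definition prime_field_emb :: "'p::prime_card mod_ring \<Rightarrow> 'k::field" where
  "prime_field_emb c = of_int (to_int_mod_ring c)"

text \<open>
  \<open>g_poly TYPE('f) n\<close> is \<open>g\<^bsub>n,q\<^esub>\<close> where \<open>'f\<close> is a field with \<open>q\<close> elements. It is meaningful only if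
  \<open>CARD('p)\<close> is the characteristic of \<open>'f\<close>. The functional equation is an identity in
  \<open>F\<^sub>q[X]\<close>.
\<close>

definition g_poly :: "'f::{finite,field} itself \<Rightarrow> nat \<Rightarrow> 'p::prime_card mod_ring poly" where
  "g_poly _ n = (THE g :: 'p mod_ring poly.
     (\<Sum>c\<in>(UNIV :: 'f set). [:c, 1:] ^ n)
       = pcompose (map_poly prime_field_emb g) (monom 1 CARD('f) - monom 1 1))"

definition S_poly :: "nat \<Rightarrow> nat \<Rightarrow> 'r::comm_ring_1 poly" where
  "S_poly q a = (\<Sum>i<a. monom 1 (q ^ i))"

definition permutation_poly :: "'k::{finite,field} poly \<Rightarrow> bool" where
  "permutation_poly f \<longleftrightarrow> bij (poly f)"

end

theory Submission
  imports Defs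
begin

text \<open>
  Write \<open>s = S\<^sub>a\<close>, \<open>t = S\<^sub>e\<close>, \<open>u = S\<^sub>e\<^sub>+\<^sub>a\<close>. Since \<open>c\<^sup>4 = c\<close> on \<open>F\<^sub>4\<close> and
  \<open>X\<close> to the power \<open>4\<^sup>k\<close> is \<open>X + S\<^sub>k(X\<^sup>4 - X)\<close>, the base-4 digits of \<open>n\<close> turn \<open>(X + c)\<^sup>n\<close> into
  \<open>Z (Z + s)\<^sup>3 (Z + t) (Z + u)\<^sup>2\<close>, where \<open>Z = X + c\<close> and \<open>s\<close>, \<open>t\<close>, \<open>u\<close> are evaluated at
  \<open>T = X\<^sup>4 - X\<close>. As \<open>Z\<^sup>4 = Z + T\<close>, this product equals a cubic in \<open>Z\<close> whose coefficients do
  not involve \<open>c\<close>, and summing over \<open>c\<close> leaves just the coefficient of \<open>Z\<^sup>3\<close>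
  (\<open>F4_sum_cubic\<close>). This gives \<open>g\<close> in closed form (\<open>g_poly_F4_explicit\<close>). Modulo \<open>X\<close> to the power
  \<open>4\<^sup>e\<close> minus \<open>X\<close> the polynomial \<open>t\<close> is fixed by fourth powers, hence \<open>u\<close> becomes \<open>s + t\<close>, and
  the closed form collapses to the stated one (\<open>g_poly_F4_cong\<close>).

  For the permutation property, \<open>S\<^sub>e\<close> induces the trace from \<open>F\<^sub>Q\<close>, with \<open>Q = 4\<^sup>e\<close>, to \<open>F\<^sub>4\<close>. When
  \<open>e\<close> is even, the trace vanishes on \<open>F\<^sub>4\<close>, and \<open>g(x)\<close> has the same trace as \<open>x\<close>. So if
  \<open>g(x) = g(y)\<close>, then \<open>x\<close> and \<open>y\<close> share the trace \<open>t\<close>, and for fixed \<open>t\<close> the map is additive up to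
  a constant: \<open>z = x - y\<close> is a zero of an additive polynomial with coefficients \<open>t\<^sup>2\<close> and \<open>t\<^sup>3\<close>.
  The case \<open>t = 0\<close> is immediate; otherwise substituting \<open>z = t v\<close> removes \<open>t\<close>, and the equation
  says that the sum of the \<open>2\<^sup>i\<close>-th powers of \<open>v\<close> over \<open>i \<le> 2a\<close> is zero
  (\<open>quadratic_S_poly_eq_imp_zero\<close>). Then \<open>v\<close> is fixed by the \<open>(2a+1)\<close>-th iterate of
  squaring, as well as by the \<open>2e\<close>-th one; these numbers are coprime, so \<open>v\<close> is \<open>0\<close> or \<open>1\<close>, and
  \<open>1\<close> is excluded because the sum has an odd number of terms.
\<close>


section \<open>Finite fields and the prime field\<close>

lemma CHAR_eq_if_CARD_prime_power:
  assumes "CARD('k::{finite,field}) = p ^ m" and "prime p"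
  shows "CHAR('k) = p"
proof -
  have "CHAR('k) dvd p ^ m"
    using CHAR_dvd_CARD[where ?'a = 'k] assms(1) by simp
  moreover have "prime CHAR('k)"
    using finite_imp_CHAR_pos[where ?'a = 'k] by (intro prime_CHAR_semidom) simp_all
  ultimately show ?thesis
    using assms(2) prime_dvd_power primes_dvd_imp_eq by blast
qed

lemma finite_field_pow_card:
  fixes x :: "'k::{finite,field}"
  shows "x ^ CARD('k) = x"
proof (cases "x = 0")
  case False
  let ?U = "UNIV - {0::'k}"
  have "(\<Prod>y\<in>?U. x * y) = (\<Prod>y\<in>?U. y)"
    by (rule prod.reindex_bij_witness[of _ "\<lambda>y. y / x" "\<lambda>y. x * y"]) (use False in auto)
  hence "x ^ card ?U * (\<Prod>y\<in>?U. y) = (\<Prod>y\<in>?U. y)"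
    by (simp add: prod.distrib)
  hence "x ^ card ?U = 1"
    by simp
  moreover have "CARD('k) = Suc (card ?U)"
    by (rule card.remove) simp_all
  ultimately show ?thesis
    by (simp only: power_Suc mult_1_right)
qed (simp add: finite_UNIV_card_ge_0)

lemma freshmans_dream_diff:
  fixes x y :: "'a::comm_ring_1"
  assumes "prime CHAR('a)" and "m = CHAR('a) ^ k"
  shows "(x - y) ^ m = x ^ m - y ^ m"
  using freshmans_dream'[OF assms, of "x - y" y] by (simp add: algebra_simps)

text \<open>
  Taking representatives is additive and multiplicative only modulo \<open>p\<close>; equality of the
  characteristics is what makes the reduction modulo \<open>p\<close> invisible in the target.
\<close>

lemma prime_field_emb_hom:
  assumes "CHAR('k::field) = CARD('p::prime_card)"
  shows "inj_comm_ring_hom (prime_field_emb :: 'p mod_ring \<Rightarrow> 'k)"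
proof -
  interpret comm_ring_hom "prime_field_emb :: 'p mod_ring \<Rightarrow> 'k"
    by unfold_locales
      (simp_all add: prime_field_emb_def to_int_mod_ring_add to_int_mod_ring_mult
        flip: assms of_int_add of_int_mult)
  interpret field_hom "prime_field_emb :: 'p mod_ring \<Rightarrow> 'k" ..
  show ?thesis ..
qed

text \<open>
  The functional equation determines its solution because composition with the nonconstant
  polynomial \<open>X\<^sup>q - X\<close> is injective over a domain and the prime field embeds into \<open>F\<^sub>q\<close>.
\<close>

lemma g_poly_eqI:
  fixes g :: "'p::prime_card mod_ring poly"
  assumes char: "CHAR('f::{finite,field}) = CARD('p)"
    and g: "(\<Sum>c\<in>(UNIV :: 'f set). [:c, 1:] ^ n)
       = pcompose (map_poly prime_field_emb g) (monom 1 CARD('f) - monom 1 1)"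
  shows "g_poly TYPE('f) n = g"
  unfolding g_poly_def
proof (rule the_equality)
  fix h :: "'p mod_ring poly"
  let ?T = "monom 1 CARD('f) - monom 1 1 :: 'f poly"
  let ?E = "map_poly prime_field_emb :: 'p mod_ring poly \<Rightarrow> 'f poly"
  interpret emb: inj_comm_ring_hom "prime_field_emb :: 'p mod_ring \<Rightarrow> 'f"
    by (rule prime_field_emb_hom[OF char])
  interpret E: map_poly_inj_comm_ring_hom "prime_field_emb :: 'p mod_ring \<Rightarrow> 'f" ..
  assume h: "(\<Sum>c\<in>(UNIV :: 'f set). [:c, 1:] ^ n) = ?E h \<circ>\<^sub>p ?T"
  have "card {0, 1 :: 'f} \<le> CARD('f)"
    by (intro card_mono) auto
  hence "coeff ?T CARD('f) \<noteq> 0" and card: "CARD('f) > 1"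
    by auto
  hence deg: "degree ?T > 0"
    using le_degree[of ?T "CARD('f)"] by linarith
  have "(?E h - ?E g) \<circ>\<^sub>p ?T = 0"
    using g h by (simp add: pcompose_diff)
  hence "?E h = ?E g"
    using pcompose_eq_0[OF _ deg] by fastforce
  thus "h = g"
    by simp
qed (fact g)

section \<open>Identities for the polynomials \<open>S\<^sub>a\<close>\<close>

text \<open>
  By the freshman's dream, substituting \<open>X\<^sup>q - X\<close> turns each term of \<open>S\<^sub>a\<close> into a difference of
  consecutive iterates of the Frobenius map, and the sum telescopes.
\<close>

lemma S_poly_pcompose:
  assumes "prime CHAR('a::field)" and q: "q = CHAR('a) ^ m"
  shows "S_poly q a \<circ>\<^sub>p (monom 1 q - monom 1 1) = (monom 1 (q ^ a) - monom 1 1 :: 'a poly)"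
proof (induction a)
  case 0
  thus ?case by (simp add: S_poly_def)
next
  case (Suc a)
  have "(monom 1 q - monom 1 1 :: 'a poly) ^ (q ^ a) = monom 1 (q ^ Suc a) - monom 1 (q ^ a)"
    using assms
    by (subst freshmans_dream_diff[where k = "m * a"])
       (simp_all add: power_mult monom_power)
  moreover have "monom 1 k \<circ>\<^sub>p r = r ^ k" for k and r :: "'a poly"
    by (induction k) (simp_all add: monom_0 monom_Suc pcompose_pCons)
  ultimately show ?case
    using Suc by (simp add: S_poly_def pcompose_add)
qed

text \<open>
  Raising to the power \<open>q\<close> shifts the exponents by one step, so only the two boundary terms survive.
\<close>

lemma S_poly_power_minus:
  assumes "prime CHAR('a::comm_ring_1)" and q: "q = CHAR('a) ^ m"
  shows "S_poly q a ^ q - S_poly q a = (monom 1 (q ^ a) - monom 1 1 :: 'a poly)"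
proof -
  have "(S_poly q a :: 'a poly) ^ q = (\<Sum>i<a. monom 1 (q ^ Suc i))"
    unfolding S_poly_def using assms
    by (subst freshmans_dream_sum'[where n = m]) (simp_all add: monom_power mult.commute)
  thus ?thesis
    unfolding S_poly_def
    using sum_lessThan_telescope[of "\<lambda>i. monom (1::'a) (q ^ i)" a]
    by (simp add: sum_subtractf)
qed

lemma S_poly_add:
  assumes "prime CHAR('a::comm_ring_1)" and q: "q = CHAR('a) ^ m"
  shows "S_poly q (a + b) = (S_poly q a + S_poly q b ^ q ^ a :: 'a poly)"
proof -
  have "prime CHAR('a poly)" and "q ^ a = CHAR('a poly) ^ (m * a)"
    using assms by (simp_all add: power_mult)
  hence "(S_poly q b :: 'a poly) ^ q ^ a = (\<Sum>i<b. monom 1 (q ^ i) ^ q ^ a)"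
    unfolding S_poly_def by (rule freshmans_dream_sum')
  also have "\<dots> = (\<Sum>i<b. monom 1 (q ^ (a + i)))"
    by (simp add: monom_power power_add mult.commute)
  finally have "(S_poly q b :: 'a poly) ^ q ^ a = (\<Sum>i<b. monom 1 (q ^ (a + i)))" .
  moreover have "S_poly q (a + b) = S_poly q a + (\<Sum>i<b. monom (1::'a) (q ^ (a + i)))"
    by (induction b) (simp_all add: S_poly_def add.assoc)
  ultimately show ?thesis
    by simp
qed

section \<open>Sums over the field with four elements\<close>

lemma F4_elements:
  assumes card: "CARD('f::{finite,field}) = 4"
  obtains w where "UNIV = {0, 1, w, w + 1 :: 'f}" and "distinct [0, 1, w, w + 1]"
    and "w ^ 2 = w + 1"
proof -
  have "CHAR('f) = 2"
    using CHAR_eq_if_CARD_prime_power[where ?'k = 'f and p = 2 and m = 2] card by simp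
  hence two: "x + x = 0" for x :: 'f
    using uminus_CHAR_2 by (metis add.right_inverse)
  have "\<not> (UNIV :: 'f set) \<subseteq> {0, 1}"
    using card_mono[of "{0, 1 :: 'f}" UNIV] card by auto
  then obtain w :: 'f where w: "w \<noteq> 0" "w \<noteq> 1"
    by blast
  have "w + 1 \<noteq> 0"
    using w(2) two[of 1] by (metis add_right_cancel)
  hence w1: "w + 1 \<noteq> 0" "w + 1 \<noteq> 1" "w + 1 \<noteq> w"
    using w by simp_all
  hence d: "distinct [0, 1, w, w + 1]"
    using w by auto
  hence "card {0, 1, w, w + 1} = 4"
    using distinct_card[OF d] by simp
  hence U: "UNIV = {0, 1, w, w + 1}"
    using card card_subset_eq[of UNIV "{0, 1, w, w + 1}"] by simp
  \<comment> \<open>The square of \<open>w\<close> is one of the four elements, and three of them can be ruled out.\<close>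
  have "w ^ 2 \<noteq> 0" "w ^ 2 \<noteq> w"
    using w by (auto simp: power2_eq_square)
  moreover have "w ^ 2 + 1 = (w + 1) ^ 2"
    using two[of w] by (simp add: power2_eq_square algebra_simps)
  hence "w ^ 2 \<noteq> 1"
    using w1(1) two[of 1] by auto
  ultimately have "w ^ 2 = w + 1"
    using U by (metis UNIV_I insertE singletonD)
  thus thesis
    using that U d by blast
qed

lemma F4_power_sums:
  assumes card: "CARD('f::{finite,field}) = 4"
  shows "(\<Sum>c\<in>(UNIV::'f set). c) = 0" and "(\<Sum>c\<in>(UNIV::'f set). c ^ 2) = 0"
    and "(\<Sum>c\<in>(UNIV::'f set). c ^ 3) = 1"
proof -
  obtain w :: 'f where U: "UNIV = {0, 1, w, w + 1}" and d: "distinct [0, 1, w, w + 1]"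
    and w: "w ^ 2 = w + 1"
    using F4_elements[OF card] .
  have "CHAR('f) = 2"
    using CHAR_eq_if_CARD_prime_power[where ?'k = 'f and p = 2 and m = 2] card by simp
  hence two: "(2 :: 'f) = 0"
    by (metis of_nat_CHAR of_nat_numeral)
  have sum4: "(\<Sum>c\<in>UNIV. f c) = f 0 + (f 1 + (f w + f (w + 1)))" for f :: "'f \<Rightarrow> 'f"
    unfolding U using d by simp
  have "w ^ 3 = w * w ^ 2"
    by (simp add: power3_eq_cube power2_eq_square)
  also have "\<dots> = w ^ 2 + w"
    unfolding w by (simp add: power2_eq_square[symmetric] algebra_simps w)
  also have "\<dots> = 2 * w + 1"
    unfolding w by simp
  finally have cube: "w ^ 3 = 1"
    using two by simp
  have "(w + 1) ^ 3 = (w ^ 3) ^ 2"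
    unfolding w[symmetric] by (simp flip: power_mult)
  hence cube': "(w + 1) ^ 3 = 1"
    using cube by simp
  show "(\<Sum>c\<in>(UNIV::'f set). c) = 0"
  proof -
    have "0 + (1 + (w + (w + 1))) = 2 * (w + 1)"
      by simp
    thus ?thesis
      unfolding sum4 using two by simp
  qed
  show "(\<Sum>c\<in>(UNIV::'f set). c ^ 2) = 0"
  proof -
    have "0 ^ 2 + (1 ^ 2 + (w ^ 2 + (w + 1) ^ 2)) = 2 * (w ^ 2 + w + 1)"
      by (simp add: power2_eq_square algebra_simps)
    thus ?thesis
      unfolding sum4 using two by simp
  qed
  show "(\<Sum>c\<in>(UNIV::'f set). c ^ 3) = 1"
    unfolding sum4 cube cube' using two by simp
qed

text \<open>
  Expanding in \<open>c\<close>, the power sums of degrees \<open>1\<close> and \<open>2\<close> vanish, the constant term is multiplied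
  by \<open>4 = 0\<close>, and the power sum of degree \<open>3\<close> is \<open>1\<close>.
\<close>

lemma F4_sum_cubic:
  fixes c0 c1 c2 c3 :: "'f::{finite,field} poly"
  assumes card: "CARD('f::{finite,field}) = 4"
  shows "(\<Sum>c\<in>UNIV. c3 * [:c, 1:] ^ 3 + c2 * [:c, 1:] ^ 2 + c1 * [:c, 1:] + c0) = c3"
proof -
  let ?X = "[:0, 1:] :: 'f poly"
  have "CHAR('f) = 2"
    using CHAR_eq_if_CARD_prime_power[where ?'k = 'f and p = 2 and m = 2] card by simp
  hence two: "(2 :: 'f poly) = 0"
    by (metis semiring_char_poly of_nat_CHAR of_nat_numeral)
  have const: "(\<Sum>c\<in>UNIV. [:c::'f:] ^ k) = [:\<Sum>c\<in>UNIV. c ^ k:]" for k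
    by (simp add: poly_const_pow sum_to_poly)
  have const_sums: "(\<Sum>c\<in>UNIV. [:c::'f:] ^ 1) = 0" "(\<Sum>c\<in>UNIV. [:c::'f:] ^ 2) = 0"
    "(\<Sum>c\<in>UNIV. [:c::'f:] ^ 3) = 1"
    using const[of 1] const[of 2] const[of 3] by (simp_all add: F4_power_sums[OF card])
  have four: "(of_nat CARD('f) :: 'f poly) = 0"
    using two unfolding card by (metis mult_zero_left of_nat_numeral numeral_Bit0_eq_double)
  have expand: "c3 * (X + C) ^ 3 + c2 * (X + C) ^ 2 + c1 * (X + C) + c0 =
      c3 * C ^ 3 + ((3 * c3 * X + c2) * C ^ 2 + ((3 * c3 * X ^ 2 + 2 * c2 * X + c1) * C ^ 1
      + (c3 * X ^ 3 + c2 * X ^ 2 + c1 * X + c0)))" for X C :: "'f poly"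
    by (simp add: power2_eq_square power3_eq_cube algebra_simps)
  have "(\<Sum>c\<in>UNIV. c3 * [:c, 1:] ^ 3 + c2 * [:c, 1:] ^ 2 + c1 * [:c, 1:] + c0) =
    (\<Sum>c\<in>UNIV. c3 * [:c:] ^ 3 + ((3 * c3 * ?X + c2) * [:c:] ^ 2
      + ((3 * c3 * ?X ^ 2 + 2 * c2 * ?X + c1) * [:c:] ^ 1
      + (c3 * ?X ^ 3 + c2 * ?X ^ 2 + c1 * ?X + c0))))"
  proof (rule sum.cong)
    fix c :: 'f
    have c: "[:c, 1:] = ?X + [:c:]"
      by simp
    show "c3 * [:c, 1:] ^ 3 + c2 * [:c, 1:] ^ 2 + c1 * [:c, 1:] + c0 =
      c3 * [:c:] ^ 3 + ((3 * c3 * ?X + c2) * [:c:] ^ 2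
      + ((3 * c3 * ?X ^ 2 + 2 * c2 * ?X + c1) * [:c:] ^ 1
      + (c3 * ?X ^ 3 + c2 * ?X ^ 2 + c1 * ?X + c0)))"
      unfolding c by (rule expand)
  qed (rule refl)
  also have "\<dots> = c3 * 1 + ((3 * c3 * ?X + c2) * 0
      + ((3 * c3 * ?X ^ 2 + 2 * c2 * ?X + c1) * 0
      + of_nat CARD('f) * (c3 * ?X ^ 3 + c2 * ?X ^ 2 + c1 * ?X + c0)))"
    unfolding sum.distrib sum_distrib_left[symmetric] const_sums sum_constant
    by (simp only: distrib_left mult.left_commute)
  also have "\<dots> = c3"
    unfolding four by simp
  finally show ?thesis .
qed

text \<open>
  In characteristic \<open>2\<close> the left-hand side is a polynomial of degree \<open>7\<close> in \<open>Z\<close>; this is its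
  reduction by \<open>Z\<^sup>4 = Z + T\<close>. The coefficient of \<open>Z\<^sup>3\<close> is what a sum over the translates
  \<open>Z = X + c\<close> retains.
\<close>

lemma char2_product_mod_quartic:
  fixes Z T s t u :: "'a::comm_ring_1"
  assumes two: "(2::'a) = 0" and Z: "Z ^ 4 = Z + T"
  shows "Z * (Z + s) ^ 3 * (Z + t) * (Z + u) ^ 2 =
    (T + s + t + s * t * u ^ 2 + s ^ 2 * u ^ 2 + s ^ 3 * t) * Z ^ 3
      + ((s + t) * T + u ^ 2 + s * t + s ^ 2 + s ^ 2 * t * u ^ 2 + s ^ 3 * u ^ 2) * Z ^ 2
      + (1 + (u ^ 2 + s * t + s ^ 2) * T + t * u ^ 2 + s * u ^ 2 + s ^ 2 * t + s ^ 3
           + s ^ 3 * t * u ^ 2) * Z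
      + (T + (t * u ^ 2 + s * u ^ 2 + s ^ 2 * t + s ^ 3) * T)"
proof -
  have "(Z + s) ^ 3 = Z ^ 3 + s * Z ^ 2 + s ^ 2 * Z + s ^ 3 + 2 * (s * Z ^ 2 + s ^ 2 * Z)"
    by (simp add: power2_eq_square power3_eq_cube algebra_simps)
  hence cube: "(Z + s) ^ 3 = Z ^ 3 + s * Z ^ 2 + s ^ 2 * Z + s ^ 3"
    using two by simp
  have "(Z + u) ^ 2 = Z ^ 2 + u ^ 2 + 2 * (u * Z)"
    by (simp add: power2_eq_square algebra_simps)
  hence square: "(Z + u) ^ 2 = Z ^ 2 + u ^ 2"
    using two by simp
  have reduce: "Z ^ 4 * Z = Z ^ 2 + T * Z" "Z ^ 4 * Z ^ 2 = Z ^ 3 + T * Z ^ 2"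
    "Z ^ 4 * Z ^ 3 = Z + T + T * Z ^ 3"
    using Z by (simp_all add: eval_nat_numeral algebra_simps)
  have "Z * (Z + s) ^ 3 * (Z + t) * (Z + u) ^ 2 =
    Z ^ 4 * Z ^ 3 + (s + t) * (Z ^ 4 * Z ^ 2) + (u ^ 2 + s * t + s ^ 2) * (Z ^ 4 * Z)
      + (t * u ^ 2 + s * u ^ 2 + s ^ 2 * t + s ^ 3) * Z ^ 4
      + (s * t * u ^ 2 + s ^ 2 * u ^ 2 + s ^ 3 * t) * Z ^ 3
      + (s ^ 2 * t * u ^ 2 + s ^ 3 * u ^ 2) * Z ^ 2 + s ^ 3 * t * u ^ 2 * Z"
    unfolding cube square by (simp add: eval_nat_numeral algebra_simps)
  thus ?thesis
    unfolding reduce unfolding Z by (simp add: algebra_simps)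
qed

section \<open>The polynomial \<open>g\<close> in closed form\<close>

lemma g_poly_F4_explicit:
  assumes p: "CARD('p::prime_card) = 2" and q: "CARD('f::{finite,field}) = 4"
    and n: "n = 1 + 3 * 4 ^ a + 4 ^ e + 2 * 4 ^ (e + a)"
  shows "(g_poly TYPE('f) n :: 'p mod_ring poly) =
    monom 1 1 + S_poly 4 a + S_poly 4 e + S_poly 4 a * S_poly 4 e * S_poly 4 (e + a) ^ 2
      + S_poly 4 a ^ 2 * S_poly 4 (e + a) ^ 2 + S_poly 4 a ^ 3 * S_poly 4 e"
    (is "_ = ?g")
proof (rule g_poly_eqI)
  have char: "CHAR('f) = 2"
    using CHAR_eq_if_CARD_prime_power[where ?'k = 'f and p = 2 and m = 2] q by simp
  thus "CHAR('f) = CARD('p)"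
    using p by simp
  then interpret inj_comm_ring_hom "prime_field_emb :: 'p mod_ring \<Rightarrow> 'f"
    by (rule prime_field_emb_hom)
  interpret E: map_poly_inj_comm_ring_hom "prime_field_emb :: 'p mod_ring \<Rightarrow> 'f" ..
  have two: "(2 :: 'f poly) = 0"
    using char by (metis semiring_char_poly of_nat_CHAR of_nat_numeral)
  \<comment> \<open>\<open>D k\<close> is \<open>S\<^sub>k\<close> evaluated at \<open>D 1 = X\<^sup>4 - X\<close>.\<close>
  define D where "D k = (monom 1 (4 ^ k) - monom 1 1 :: 'f poly)" for k
  have D1: "D 1 = monom 1 4 - monom 1 1"
    by (simp add: D_def)
  have S: "S_poly 4 k \<circ>\<^sub>p D 1 = D k" for k
    unfolding D_def using S_poly_pcompose[where ?'a = 'f and m = 2 and q = 4] char by simp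
  have ES: "map_poly prime_field_emb (S_poly 4 k :: 'p mod_ring poly) = (S_poly 4 k :: 'f poly)" for k
    by (simp add: S_poly_def E.hom_sum)
  have Z: "[:c, 1:] ^ (4 ^ k) = [:c, 1:] + D k" for c :: 'f and k
  proof -
    have c: "c ^ 4 ^ k = c"
      by (induction k) (use finite_field_pow_card[of c] q in \<open>simp_all add: power_mult\<close>)
    have "[:c, 1:] = monom 1 1 + [:c:]"
      by (simp add: monom_Suc monom_0)
    moreover have "(monom 1 1 + [:c:]) ^ (4 ^ k) = monom 1 1 ^ 4 ^ k + [:c:] ^ 4 ^ k"
      by (rule freshmans_dream'[where n = "2 * k"]) (simp_all add: char power_mult)
    ultimately show ?thesis
      by (simp add: D_def poly_const_pow c monom_power)
  qed
  have prod: "[:c, 1:] ^ n =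
    [:c, 1:] * ([:c, 1:] + D a) ^ 3 * ([:c, 1:] + D e) * ([:c, 1:] + D (e + a)) ^ 2" for c :: 'f
  proof -
    have "[:c, 1:] ^ n = [:c, 1:] * ([:c, 1:] ^ (4 ^ a)) ^ 3 * [:c, 1:] ^ (4 ^ e)
        * ([:c, 1:] ^ (4 ^ (e + a))) ^ 2"
      unfolding n by (simp only: power_add power_one_right mult.commute flip: power_mult)
    thus ?thesis
      unfolding Z .
  qed
  have "(\<Sum>c\<in>(UNIV :: 'f set). [:c, 1:] ^ n) =
    D 1 + D a + D e + D a * D e * D (e + a) ^ 2 + D a ^ 2 * D (e + a) ^ 2 + D a ^ 3 * D e"
    unfolding prod char2_product_mod_quartic[OF two Z[where k = 1, unfolded power_one_right]]
    by (rule F4_sum_cubic[OF q])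
  also have "\<dots> = map_poly prime_field_emb ?g \<circ>\<^sub>p D 1"
    by (simp add: E.hom_add E.hom_mult E.hom_power ES S[unfolded One_nat_def]
        pcompose_hom.hom_add pcompose_hom.hom_mult pcompose_hom.hom_power monom_Suc monom_0)
  finally show "(\<Sum>c\<in>(UNIV :: 'f set). [:c, 1:] ^ n) =
      map_poly prime_field_emb ?g \<circ>\<^sub>p (monom 1 CARD('f) - monom 1 1)"
    by (simp only: q D1)
qed

text \<open>
  The congruence holds because \<open>t\<^sup>4 - t\<close> is the modulus itself, for \<open>t = S\<^sub>e\<close>, which lets the
  summand \<open>S\<^sub>e\<close> to the power \<open>4\<^sup>a\<close> of \<open>S\<^sub>e\<^sub>+\<^sub>a\<close> be replaced by \<open>S\<^sub>e\<close>.
\<close>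

lemma g_poly_F4_cong:
  assumes p: "CARD('p::prime_card) = 2" and q: "CARD('f::{finite,field}) = 4"
    and n: "n = 1 + 3 * 4 ^ a + 4 ^ e + 2 * 4 ^ (e + a)"
  shows "[(g_poly TYPE('f) n :: 'p mod_ring poly) =
     monom 1 (4 ^ a) + S_poly 4 e + S_poly 4 a ^ 2 * S_poly 4 e ^ 2
       + S_poly 4 a * S_poly 4 e ^ 3] (mod (monom 1 (4 ^ e) - monom 1 1))"
proof -
  define s t u :: "'p mod_ring poly"
    where "s = S_poly 4 a" and "t = S_poly 4 e" and "u = S_poly 4 (e + a)"
  let ?M = "monom 1 (4 ^ e) - monom 1 1 :: 'p mod_ring poly"
  have char: "CHAR('p mod_ring) = 2"
    using p by simp
  have two: "(2 :: 'p mod_ring poly) = 0"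
    using char by (metis semiring_char_poly of_nat_CHAR of_nat_numeral)
  have step: "S_poly 4 k ^ 4 - S_poly 4 k = (monom 1 (4 ^ k) - monom 1 1 :: 'p mod_ring poly)" for k
    by (rule S_poly_power_minus[where m = 2]) (use p char in simp_all)
  have t4: "[t ^ 4 ^ k = t] (mod ?M)" for k
  proof (induction k)
    case (Suc k)
    have "[(t ^ 4 ^ k) ^ 4 = t ^ 4] (mod ?M)"
      by (rule cong_pow[OF Suc])
    moreover have "[t ^ 4 = t] (mod ?M)"
      unfolding cong_iff_dvd_diff t_def step by (rule dvd_refl)
    ultimately have "[(t ^ 4 ^ k) ^ 4 = t] (mod ?M)"
      by (rule cong_trans)
    thus ?case
      by (simp only: power_Suc2 power_mult)
  qed simp
  have "u = s + t ^ 4 ^ a"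
    unfolding u_def s_def t_def
    by (subst add.commute, rule S_poly_add[where m = 2]) (use p char in simp_all)
  hence u: "[u = s + t] (mod ?M)"
    using t4 cong_add[OF cong_refl] by blast
  have "monom 1 1 + s + t + s * t * (s + t) ^ 2 + s ^ 2 * (s + t) ^ 2 + s ^ 3 * t =
      (monom 1 1 + s + s ^ 4) + t + s ^ 2 * t ^ 2 + s * t ^ 3 
      + 2 * (s ^ 3 * t + s ^ 2 * t ^ 2 + s ^ 3 * t)"
    by (simp add: eval_nat_numeral algebra_simps)
  \<comment> \<open>The leading power of \<open>X\<close> in the statement comes from \<open>s\<^sup>4 - s\<close>, which telescopes.\<close>
  also have "monom 1 1 + s + s ^ 4 = monom 1 (4 ^ a)"
  proof -
    have "s ^ 4 - s = monom 1 (4 ^ a) - monom 1 1"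
      unfolding s_def by (rule step)
    hence "monom 1 1 + s + s ^ 4 = monom 1 (4 ^ a) + 2 * s"
      by (simp add: algebra_simps)
    thus ?thesis
      using two by simp
  qed
  finally have formula: "monom 1 1 + s + t + s * t * (s + t) ^ 2 + s ^ 2 * (s + t) ^ 2 + s ^ 3 * t =
      monom 1 (4 ^ a) + t + s ^ 2 * t ^ 2 + s * t ^ 3"
    using two by simp
  have "[g_poly TYPE('f) n =
      monom 1 1 + s + t + s * t * (s + t) ^ 2 + s ^ 2 * (s + t) ^ 2 + s ^ 3 * t] (mod ?M)"
    unfolding g_poly_F4_explicit[OF assms] s_def[symmetric] t_def[symmetric] u_def[symmetric]
    by (intro cong_add cong_mult cong_pow cong_refl u)
  thus ?thesis
    unfolding formula unfolding s_def t_def .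
qed

section \<open>The functions induced by \<open>S\<^sub>a\<close>\<close>

lemma poly_S_poly: "poly (S_poly q a) x = (\<Sum>i<a. x ^ (q ^ i))"
  by (simp add: S_poly_def poly_sum poly_monom)

lemma poly_S_poly_add:
  fixes x y :: "'k::comm_ring_1"
  assumes "prime CHAR('k)" and "q = CHAR('k) ^ m"
  shows "poly (S_poly q a) (x + y) = poly (S_poly q a) x + poly (S_poly q a) y"
proof -
  have "(x + y) ^ q ^ i = x ^ q ^ i + y ^ q ^ i" for i
    using assms by (intro freshmans_dream'[where n = "m * i"]) (simp_all add: power_mult)
  thus ?thesis
    by (simp add: poly_S_poly sum.distrib)
qed

lemma poly_S_poly_char_power:
  fixes x :: "'k::comm_ring_1"
  assumes "prime CHAR('k)" and "r = CHAR('k) ^ m"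
  shows "poly (S_poly q a) (x ^ r) = poly (S_poly q a) x ^ r"
proof -
  have "poly (S_poly q a) x ^ r = (\<Sum>i<a. (x ^ q ^ i) ^ r)"
    unfolding poly_S_poly by (rule freshmans_dream_sum'[OF assms])
  thus ?thesis
    by (simp add: poly_S_poly mult.commute flip: power_mult)
qed

lemma pow_pow_eq_if_pow_eq:
  fixes c :: "'k::monoid_mult"
  assumes "c ^ q = c"
  shows "c ^ q ^ i = c"
  by (induction i) (simp_all add: assms power_mult)

lemma poly_S_poly_scale:
  fixes c x :: "'k::comm_ring_1"
  assumes "c ^ q = c"
  shows "poly (S_poly q a) (c * x) = c * poly (S_poly q a) x"
  by (simp add: poly_S_poly power_mult_distrib pow_pow_eq_if_pow_eq[OF assms] sum_distrib_left)

lemma poly_S_poly_const: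
  fixes c :: "'k::comm_ring_1"
  assumes "c ^ q = c"
  shows "poly (S_poly q a) c = of_nat a * c"
  by (simp add: poly_S_poly pow_pow_eq_if_pow_eq[OF assms])

lemma poly_S_poly_power_minus:
  fixes x :: "'k::comm_ring_1"
  assumes "prime CHAR('k)" and "q = CHAR('k) ^ m"
  shows "poly (S_poly q a) x ^ q - poly (S_poly q a) x = x ^ q ^ a - x"
  using arg_cong[OF S_poly_power_minus[OF assms, of a], of "\<lambda>f. poly f x"]
  by (simp add: poly_monom)

text \<open>
  When \<open>x\<close> is fixed by the \<open>q\<^sup>e\<close>-th power, \<open>S\<^sub>e\<close> acts as a trace: it takes the same value on all
  conjugates of \<open>x\<close>, and \<open>S\<^sub>a(x)\<close> is a sum of \<open>a\<close> of them.
\<close>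

lemma trace_S_poly:
  fixes x :: "'k::comm_ring_1"
  assumes "prime CHAR('k)" and q: "q = CHAR('k) ^ m" and x: "x ^ q ^ e = x"
  shows "poly (S_poly q e) (poly (S_poly q a) x) = of_nat a * poly (S_poly q e) x"
proof -
  have "poly (S_poly q e) x ^ q = poly (S_poly q e) x"
    using poly_S_poly_power_minus[OF assms(1,2), of e x] x by simp
  hence "poly (S_poly q e) x ^ q ^ i = poly (S_poly q e) x" for i
    by (rule pow_pow_eq_if_pow_eq)
  hence conj: "poly (S_poly q e) (x ^ q ^ i) = poly (S_poly q e) x" for i
    using assms by (subst poly_S_poly_char_power[where m = "m * i"]) (simp_all add: power_mult)
  have zero: "poly (S_poly q e) 0 = (0 :: 'k)"
    using poly_S_poly_add[OF assms(1,2), of e 0 0] by simp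
  show ?thesis
    unfolding poly_S_poly[of q a]
    by (induction a) (simp_all add: zero conj poly_S_poly_add[OF assms(1,2)] algebra_simps)
qed

text \<open>
  The iterates of the map \<open>v \<mapsto> v\<^sup>r\<close> add in the exponent, so Bezout's identity applies to those that
  fix \<open>v\<close>; writing it as \<open>m x = n y + gcd\<close> avoids inverting the map.
\<close>

lemma fixed_by_power_gcd:
  fixes v :: "'k::monoid_mult"
  assumes "v ^ r ^ m = v" and "v ^ r ^ n = v"
  shows "v ^ r ^ gcd m n = v"
proof (cases "m = 0")
  case False
  then obtain x y where xy: "m * x = n * y + gcd m n"
    using bezout_nat by blast
  have "v ^ r ^ (m * x) = v" and n: "v ^ r ^ (n * y) = v"
    using assms by (simp_all add: power_mult pow_pow_eq_if_pow_eq)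
  thus ?thesis
    unfolding xy by (simp add: power_add power_mult n)
qed (use assms in simp)

section \<open>The permutation property\<close>

text \<open>
  In characteristic \<open>2\<close>, \<open>S\<^sub>a\<close> for \<open>q = 4\<close> collects the terms of even index of the sum of
  \<open>2a\<close> terms for \<open>q = 2\<close>, and its square collects those of odd index. The equation therefore says that \<open>v\<close> is a zero of the sum with \<open>2a + 1\<close> terms for \<open>q = 2\<close>. Such zeros are fixed by the
  \<open>(2a + 1)\<close>-th iterate of squaring, and with the coprimality this forces \<open>v\<^sup>2 = v\<close>. On such \<open>v\<close>
  the sum of an odd number of terms is \<open>v\<close> itself.
\<close>

lemma quadratic_S_poly_eq_imp_zero:
  fixes v :: "'k::idom"
  assumes char: "CHAR('k) = 2" and v: "v ^ 2 ^ m = v" and coprime: "coprime m (2 * a + 1)"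
    and eq: "v ^ 4 ^ a = poly (S_poly 4 a) v + poly (S_poly 4 a) v ^ 2"
  shows "v = 0"
proof -
  have half: "poly (S_poly 2 (2 * b)) v = poly (S_poly 4 b) v + poly (S_poly 4 b) v ^ 2" for b
  proof -
    have "poly (S_poly 4 b) v ^ 2 = (\<Sum>i<b. (v ^ 4 ^ i) ^ 2)"
      unfolding poly_S_poly by (rule freshmans_dream_sum) (simp_all add: char)
    moreover have "poly (S_poly 2 (2 * b)) v = (\<Sum>i<b. v ^ 4 ^ i) + (\<Sum>i<b. (v ^ 4 ^ i) ^ 2)"
    proof (induction b)
      case (Suc b)
      have "v ^ 2 ^ (2 * b) = v ^ 4 ^ b"
        by (simp add: power_mult)
      moreover have "v ^ 2 ^ Suc (2 * b) = (v ^ 4 ^ b) ^ 2"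
        by (simp only: power_Suc2 power_mult) simp
      ultimately show ?case
        using Suc by (simp add: poly_S_poly)
    qed (simp add: poly_S_poly)
    ultimately show ?thesis
      by (simp add: poly_S_poly)
  qed
  have zero: "poly (S_poly 2 (2 * a + 1)) v = 0"
  proof -
    have "poly (S_poly 2 (2 * a + 1)) v = poly (S_poly 2 (2 * a)) v + v ^ 2 ^ (2 * a)"
      by (simp add: poly_S_poly)
    also have "\<dots> = v ^ 4 ^ a + v ^ 4 ^ a"
      by (simp add: half eq power_mult)
    finally show ?thesis
      using uminus_CHAR_2[OF char] by (metis add.right_inverse)
  qed
  have "v ^ 2 ^ (2 * a + 1) - v =
      poly (S_poly 2 (2 * a + 1)) v ^ 2 - poly (S_poly 2 (2 * a + 1)) v"
    by (rule poly_S_poly_power_minus[symmetric, where m = 1]) (simp_all only: char, simp_all)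
  also have "\<dots> = 0"
    unfolding zero by simp
  finally have "v ^ 2 ^ (2 * a + 1) = v"
    by (simp only: right_minus_eq)
  with v have "v ^ 2 ^ gcd m (2 * a + 1) = v"
    by (rule fixed_by_power_gcd)
  hence v2: "v ^ 2 = v"
    using coprime by (simp only: coprime_iff_gcd_eq_1 power_one_right)
  have "(of_nat (2 * a + 1) :: 'k) = of_nat 2 * of_nat a + 1"
    by simp
  hence odd: "(of_nat (2 * a + 1) :: 'k) = 1"
    using of_nat_CHAR[where ?'a = 'k] unfolding char by simp
  show "v = 0"
    using zero unfolding poly_S_poly_const[OF v2] odd mult_1_left .
qed

text \<open>
  The trace is an invariant of \<open>f\<close>, and on each of its fibres \<open>f\<close> is a translate of an injective
  additive map. The trace of the cross terms of \<open>f\<close> is \<open>a (a + 1) t\<close>, where \<open>t\<close> is the trace of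
  the argument, and \<open>a (a + 1)\<close> is even.
\<close>

lemma permutation_F4_form:
  fixes f :: "'k::{finite,field} \<Rightarrow> 'k"
  assumes card: "CARD('k) = 4 ^ e" and e: "even e" and coprime: "coprime e (2 * a + 1)"
    and f: "\<And>x. f x = x ^ 4 ^ a + poly (S_poly 4 e) x
      + poly (S_poly 4 a) x ^ 2 * poly (S_poly 4 e) x ^ 2
      + poly (S_poly 4 a) x * poly (S_poly 4 e) x ^ 3"
  shows "bij f"
proof -
  have char: "CHAR('k) = 2"
    using CHAR_eq_if_CARD_prime_power[where ?'k = 'k and p = 2 and m = "2 * e"] card
    by (simp add: power_mult)
  have p: "prime CHAR('k)" and q: "4 = CHAR('k) ^ 2"
    by (simp_all add: char)
  have even_zero: "of_nat k = (0 :: 'k)" if "even k" for k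
    using that by (simp add: of_nat_eq_0_iff_char_dvd char)
  have fermat: "x ^ 4 ^ e = x" for x :: 'k
    using finite_field_pow_card[of x] card by simp
  define S where "S = poly (S_poly 4 a :: 'k poly)"
  define Tr where "Tr = poly (S_poly 4 e :: 'k poly)"
  have S_add: "S (x + y) = S x + S y" and Tr_add: "Tr (x + y) = Tr x + Tr y" for x y
    by (simp_all add: S_def Tr_def poly_S_poly_add[OF p q])
  have Tr_pow4: "Tr x ^ 4 = Tr x" for x
    using poly_S_poly_power_minus[OF p q, of e x] fermat by (simp add: Tr_def)
  have Tr_scale: "Tr (c * x) = c * Tr x" if "c ^ 4 = c" for c x
    using that by (simp add: Tr_def poly_S_poly_scale)
  have Tr_square: "Tr (x ^ 2) = Tr x ^ 2" for x
    unfolding Tr_def by (rule poly_S_poly_char_power[OF p, where m = 1]) (simp add: char)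
  have Tr_f: "Tr (f x) = Tr x" for x
  proof -
    define t where "t = Tr x"
    have t4: "t ^ 4 = t"
      by (simp add: t_def Tr_pow4)
    have pow: "(t ^ k) ^ 4 = t ^ k" for k
      using t4 by (metis mult.commute power_mult)
    have "Tr (x ^ 4 ^ a) = t"
      unfolding Tr_def using poly_S_poly_char_power[OF p, where m = "2 * a"]
        pow_pow_eq_if_pow_eq[OF t4]
      by (simp add: char power_mult t_def Tr_def)
    moreover have "Tr t = 0"
      using poly_S_poly_const[OF t4, of e] even_zero[OF e] by (simp add: Tr_def)
    moreover have S: "Tr (S x) = of_nat a * t"
      by (simp add: Tr_def S_def t_def trace_S_poly[OF p q fermat])
    moreover have "Tr (t ^ 2 * S x ^ 2) = t ^ 2 * (of_nat a * t) ^ 2"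
      by (simp only: Tr_scale[OF pow] Tr_square S)
    moreover have "Tr (t ^ 3 * S x) = t ^ 3 * (of_nat a * t)"
      by (simp only: Tr_scale[OF pow] S)
    moreover have "f x = x ^ 4 ^ a + t + t ^ 2 * S x ^ 2 + t ^ 3 * S x"
      unfolding f S_def Tr_def t_def by (simp add: mult.commute)
    ultimately have "Tr (f x) = t + t ^ 2 * (of_nat a * t) ^ 2 + t ^ 3 * (of_nat a * t)"
      by (simp only: Tr_add add_0_right)
    also have "\<dots> = t + of_nat (a * (a + 1)) * t ^ 4"
      by (simp add: eval_nat_numeral algebra_simps)
    also have "of_nat (a * (a + 1)) = (0 :: 'k)"
      by (rule even_zero) simp
    finally show ?thesis
      by (simp add: t_def)
  qed
  have "inj f"
  proof (rule injI)
    fix x y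
    assume fxy: "f x = f y"
    define t where "t = Tr x"
    have t4: "t ^ 4 = t"
      by (simp add: t_def Tr_pow4)
    have ty: "Tr y = t"
      using Tr_f[of x] Tr_f[of y] fxy by (simp add: t_def)
    define z where "z = x - y"
    have x: "x = z + y"
      by (simp add: z_def)
    have z4: "x ^ 4 ^ a = z ^ 4 ^ a + y ^ 4 ^ a"
      unfolding x by (rule freshmans_dream'[OF p, where n = "2 * a"]) (simp add: char power_mult)
    have Sx: "S x = S z + S y"
      unfolding x S_add ..
    have S2: "S x ^ 2 = S z ^ 2 + S y ^ 2"
      unfolding Sx by (rule freshmans_dream[OF p]) (simp add: char)
    have z: "z ^ 4 ^ a + S z ^ 2 * t ^ 2 + S z * t ^ 3 = 0"
      using fxy unfolding f S_def[symmetric] Tr_def[symmetric] t_def[symmetric] ty z4 S2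
      unfolding Sx
      by (simp add: algebra_simps)
    have "z = 0"
    proof (cases "t = 0")
      case True
      thus ?thesis
        using z by simp
    next
      case False
      \<comment> \<open>Each of the three terms scales by \<open>t\<close> under \<open>z = t v\<close>, since \<open>t\<^sup>4 = t\<close>.\<close>
      define v where "v = z / t"
      have zv: "z = t * v"
        using False by (simp add: v_def)
      have Sz: "S z = t * S v"
        unfolding zv S_def by (rule poly_S_poly_scale[OF t4])
      have "t * (v ^ 4 ^ a + (S v + S v ^ 2)) = 0"
      proof -
        have "z ^ 4 ^ a = t * v ^ 4 ^ a"
          by (simp add: zv power_mult_distrib pow_pow_eq_if_pow_eq[OF t4])
        moreover have "S z ^ 2 * t ^ 2 = t ^ 4 * S v ^ 2" "S z * t ^ 3 = t ^ 4 * S v"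
          by (simp_all add: Sz eval_nat_numeral)
        ultimately show ?thesis
          using z unfolding t4 by (simp add: algebra_simps)
      qed
      hence "v ^ 4 ^ a + (S v + S v ^ 2) = 0"
        using False by simp
      hence eq: "v ^ 4 ^ a = poly (S_poly 4 a) v + poly (S_poly 4 a) v ^ 2"
        unfolding S_def using uminus_CHAR_2[OF char] by (metis add_eq_0_iff2)
      have "v ^ 2 ^ (2 * e) = v"
        using fermat[of v] by (simp add: power_mult)
      moreover have "coprime (2 * e) (2 * a + 1)"
        using coprime by simp
      ultimately have "v = 0"
        using quadratic_S_poly_eq_imp_zero[OF char _ _ eq] by blast
      thus ?thesis
        by (simp add: zv)
    qed
    thus "x = y"
      by (simp add: x)
  qed
  thus ?thesis
    by (simp add: bij_def finite_UNIV_inj_surj)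
qed

theorem proposition3p4:
  fixes q n e a :: nat
  assumes "CARD('p::prime_card) = 2"
    and "CARD('f::{finite,field}) = q"
    and "q = 4"
    and "e > 0"
    and "a > 0"
    and "n = 1 + 3 * q ^ a + q ^ e + 2 * q ^ (e + a)"
  shows "[(g_poly TYPE('f) n :: 'p mod_ring poly) =
           monom 1 (q ^ a) + S_poly q e + S_poly q a ^ 2 * S_poly q e ^ 2
             + S_poly q a * S_poly q e ^ 3] (mod (monom 1 (q ^ e) - monom 1 1))
       \<and> (CARD('k::{finite,field}) = q ^ e \<longrightarrow> 2 dvd e \<longrightarrow> gcd e (2 * a + 1) = 1 \<longrightarrow>
           permutation_poly
             (map_poly prime_field_emb (g_poly TYPE('f) n :: 'p mod_ring poly) :: 'k poly))"
proof (intro conjI impI)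
  note [simp] = \<open>q = 4\<close>
  let ?g = "g_poly TYPE('f) n :: 'p mod_ring poly"
  let ?h = "monom 1 (4 ^ a) + S_poly 4 e + S_poly 4 a ^ 2 * S_poly 4 e ^ 2
    + S_poly 4 a * S_poly 4 e ^ 3 :: 'p mod_ring poly"
  let ?M = "monom 1 (4 ^ e) - monom 1 1 :: 'p mod_ring poly"
  have cong: "[?g = ?h] (mod ?M)"
    using assms by (intro g_poly_F4_cong) simp_all
  thus "[?g = monom 1 (q ^ a) + S_poly q e + S_poly q a ^ 2 * S_poly q e ^ 2
      + S_poly q a * S_poly q e ^ 3] (mod (monom 1 (q ^ e) - monom 1 1))"
    by simp
  assume card: "CARD('k) = q ^ e" and e: "2 dvd e" and gcd: "gcd e (2 * a + 1) = 1"
  have char: "CHAR('k) = CARD('p)"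
    using CHAR_eq_if_CARD_prime_power[where ?'k = 'k and p = 2 and m = "2 * e"] card assms(1)
    by (simp add: power_mult)
  interpret inj_comm_ring_hom "prime_field_emb :: 'p mod_ring \<Rightarrow> 'k"
    by (rule prime_field_emb_hom[OF char])
  interpret E: map_poly_inj_comm_ring_hom "prime_field_emb :: 'p mod_ring \<Rightarrow> 'k" ..
  have ES: "map_poly prime_field_emb (S_poly 4 b :: 'p mod_ring poly) = (S_poly 4 b :: 'k poly)" for b
    by (simp add: S_poly_def E.hom_sum)
  obtain r where "?g - ?h = ?M * r"
    using cong unfolding cong_iff_dvd_diff by blast
  hence r: "?g = ?h + ?M * r"
    by (simp add: diff_eq_eq add.commute)
  have "poly (map_poly prime_field_emb ?g :: 'k poly) x = x ^ 4 ^ a + poly (S_poly 4 e) x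
      + poly (S_poly 4 a) x ^ 2 * poly (S_poly 4 e) x ^ 2
      + poly (S_poly 4 a) x * poly (S_poly 4 e) x ^ 3" for x :: 'k
  proof -
    have "x ^ 4 ^ e = x"
      using finite_field_pow_card[of x] card by simp
    thus ?thesis
      unfolding r
      by (simp add: E.hom_add E.hom_mult E.hom_power E.hom_minus ES poly_monom)
  qed
  thus "permutation_poly (map_poly prime_field_emb ?g :: 'k poly)"
    unfolding permutation_poly_def
    by (rule permutation_F4_form[rotated 3])
       (use card e gcd in \<open>simp_all add: coprime_iff_gcd_eq_1\<close>)
qed

end
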